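(* Let $X=(X_1,X_2)$ be a random vector in $\mathbb{R}^2$ with strictly positive, three times continuously differentiable density $f_X$. Then $X_1$ and $X_2$ are independent if and only if $\kappa_{11}^x=0$ for all $x\in\mathbb{R}^2$.
   Context: The differential cumulant $\kappa_{11}^x$ is the mixed partial derivative of the log-density: $\kappa_{11}^x=\frac{\partial^2}{\partial x_1\partial x_2}\log f_X(x_1,x_2)$ for $x=(x_1,x_2)\in\mathbb{R}^2$. *)

theory Defs
  imports "HOL-Probability.Probability"
begin

definition partial1 :: "(real \<times> real \<Rightarrow> real) \<Rightarrow> real \<times> real \<Rightarrow> real" where
  "partial1 f x = deriv (\<lambda>t. f (t, snd x)) (fst x)"

definition partial2 :: "(real \<times> real \<Rightarrow> real) \<Rightarrow> real \<times> real \<Rightarrow> real" where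
  "partial2 f x = deriv (\<lambda>t. f (fst x, t)) (snd x)"

(* All partial derivatives of order at most k, mixed ones in any order of
   differentiation, exist and are continuous on the plane.  Existence is required
   explicitly, since deriv is a total function with unspecified values elsewhere. *)
primrec times_continuously_differentiable :: "nat \<Rightarrow> (real \<times> real \<Rightarrow> real) \<Rightarrow> bool" where
  "times_continuously_differentiable 0 f \<longleftrightarrow> continuous_on UNIV f"
| "times_continuously_differentiable (Suc k) f \<longleftrightarrow>
     continuous_on UNIV f \<and>
     (\<forall>x. (\<lambda>t. f (t, snd x)) differentiable (at (fst x))) \<and>
     (\<forall>x. (\<lambda>t. f (fst x, t)) differentiable (at (snd x))) \<and>
     times_continuously_differentiable k (partial1 f) \<and>
     times_continuously_differentiable k (partial2 f)"

definition kappa11 :: "(real \<times> real \<Rightarrow> real) \<Rightarrow> real \<times> real \<Rightarrow> real" where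
  "kappa11 f = partial1 (partial2 (\<lambda>x. ln (f x)))"

end

theory Submission
  imports Defs
begin

text \<open>
  Both properties are equivalent to the identity f(s, t) f(0, 0) = f(s, 0) f(0, t).
  The cumulant vanishes iff log f(s, t) = log f(s, 0) + log f(0, t) - log f(0, 0), by integrating
  in s and then in t. Independence only says that f agrees almost everywhere with the product of
  the two marginal densities; these need not be continuous, so they are eliminated by comparing
  the values at (s, t), (s, u), (r, t) and (r, u), and the resulting identity between values
  of f extends to all points by continuity.
\<close>

text \<open>Everything passes through the quotient \<open>partial2 f / f\<close>, the t-derivative
  of \<open>ln f\<close>. Its s-derivative is \<open>kappa11 f\<close>, so the cumulant vanishes
  exactly when this quotient depends on t alone.\<close>

lemma kappa11_eq_0_iff:
  assumes pos: "\<And>x. f x > 0"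
    and C: "times_continuously_differentiable (Suc (Suc k)) f"
  shows "(\<forall>x. kappa11 f x = 0) \<longleftrightarrow> (\<forall>s t. f (s, t) * f (0, 0) = f (s, 0) * f (0, t))"
proof -
  have D1: "((\<lambda>s. f (s, t)) has_real_derivative partial1 f (s, t)) (at s)" for s t
    using C by (simp add: partial1_def DERIV_deriv_iff_real_differentiable)
  have D2: "((\<lambda>t. f (s, t)) has_real_derivative partial2 f (s, t)) (at t)" for s t
    using C by (simp add: partial2_def DERIV_deriv_iff_real_differentiable)
  have "(\<lambda>s. partial2 f (s, t)) differentiable at s" for s t
    using C by simp
  then have D21: "((\<lambda>s. partial2 f (s, t)) has_real_derivative partial1 (partial2 f) (s, t)) (at s)"
    for s t
    by (simp add: partial1_def DERIV_deriv_iff_real_differentiable)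
  have ln_D2: "((\<lambda>t. ln (f (s, t))) has_real_derivative partial2 f (s, t) / f (s, t)) (at t)"
    for s t
    using D2[of s t] pos[of "(s, t)"] by (auto intro!: derivative_eq_intros)
  have score: "partial2 (\<lambda>x. ln (f x)) = (\<lambda>x. partial2 f x / f x)"
    by (auto simp: fun_eq_iff partial2_def[of "\<lambda>x. ln (f x)"] intro!: DERIV_imp_deriv ln_D2)
  \<comment> \<open>\<open>deriv\<close> is total, so the definition of \<open>kappa11\<close> does
    not by itself make it a derivative; the quotient rule first supplies differentiability.\<close>
  have D_score: "((\<lambda>s. partial2 f (s, t) / f (s, t)) has_real_derivative kappa11 f (s, t)) (at s)"
    for s t
  proof -
    have "(\<lambda>s. partial2 f (s, t) / f (s, t)) differentiable at s"
      using DERIV_divide[OF D21[of t s] D1[of t s]] pos[of "(s, t)"]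
      by (auto simp: real_differentiable_def)
    then show ?thesis
      unfolding kappa11_def score partial1_def
      by (simp add: DERIV_deriv_iff_real_differentiable)
  qed
  show ?thesis
  proof
    assume K: "\<forall>x. kappa11 f x = 0"
    show "\<forall>s t. f (s, t) * f (0, 0) = f (s, 0) * f (0, t)"
    proof (intro allI)
      fix s t
      \<comment> \<open>First integration: the quotient has s-derivative zero, hence keeps its value
        at s = 0. The second integration, in u, then runs from 0 to t.\<close>
      have "partial2 f (s, u) / f (s, u) = partial2 f (0, u) / f (0, u)" for u
        using D_score[of u] K by (intro DERIV_isconst_all[of "\<lambda>s. partial2 f (s, u) / f (s, u)"]) simp
      then have "((\<lambda>u. ln (f (s, u)) - ln (f (0, u))) has_real_derivative 0) (at u)" for u
        using DERIV_diff[OF ln_D2[of s u] ln_D2[of 0 u]] by simp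
      then have "ln (f (s, t)) - ln (f (0, t)) = ln (f (s, 0)) - ln (f (0, 0))"
        by (intro DERIV_isconst_all[of "\<lambda>u. ln (f (s, u)) - ln (f (0, u))"]) simp
      then have "ln (f (s, t) * f (0, 0)) = ln (f (s, 0) * f (0, t))"
        using pos by (simp add: ln_mult less_imp_neq[symmetric])
      then show "f (s, t) * f (0, 0) = f (s, 0) * f (0, t)"
        using pos by (subst (asm) ln_inj_iff) (auto intro: mult_pos_pos)
    qed
  next
    assume E: "\<forall>s t. f (s, t) * f (0, 0) = f (s, 0) * f (0, t)"
    show "\<forall>x. kappa11 f x = 0"
    proof
      fix x :: "real \<times> real"
      obtain s t where x: "x = (s, t)" by force
      have eq: "f (s, u) = f (s, 0) / f (0, 0) * f (0, u)" for s u
        using E[rule_format, of s u] pos[of "(0, 0)"] by (simp add: field_simps)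
      have partial2_eq: "partial2 f (s, t) = f (s, 0) / f (0, 0) * partial2 f (0, t)" for s t
      proof (rule DERIV_unique[OF D2])
        have "(\<lambda>u. f (s, u)) = (\<lambda>u. f (s, 0) / f (0, 0) * f (0, u))"
          by (rule ext) (rule eq)
        then show "((\<lambda>u. f (s, u)) has_real_derivative f (s, 0) / f (0, 0) * partial2 f (0, t)) (at t)"
          using DERIV_cmult[OF D2[of 0 t], of "f (s, 0) / f (0, 0)"] by simp
      qed
      \<comment> \<open>The factor \<open>f (s, 0) / f (0, 0)\<close> carries all of the dependence
        on s and cancels.\<close>
      have "partial2 f (s, t) / f (s, t) = partial2 f (0, t) / f (0, t)" for s t
        unfolding partial2_eq[of s t] eq[of s t]
        using pos[of "(s, 0)"] pos[of "(0, 0)"] by simp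
      then have "(\<lambda>s. partial2 f (s, t) / f (s, t)) = (\<lambda>s. partial2 f (0, t) / f (0, t))"
        by (rule ext)
      then have "((\<lambda>s. partial2 f (0, t) / f (0, t)) has_real_derivative kappa11 f (s, t)) (at s)"
        using D_score[of t s] by simp
      then show "kappa11 f x = 0"
        unfolding x by (rule DERIV_unique) simp
    qed
  qed
qed

text \<open>The factors \<open>u\<close> and \<open>v\<close> may be unnormalized. With integrals
  \<open>c\<close> and \<open>d\<close>, the marginal densities are \<open>u x * d\<close> and
  \<open>c * v y\<close>; total mass one forces \<open>c * d = 1\<close>, so their product is again
  the joint density.\<close>

lemma (in prob_space) indep_var_if_distributed_mult:
  assumes S: "sigma_finite_measure S" and T: "sigma_finite_measure T"
    and XY: "distributed M (S \<Otimes>\<^sub>M T) (\<lambda>\<omega>. (X \<omega>, Y \<omega>)) (\<lambda>(x, y). u x * v y)"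
    and [measurable]: "u \<in> borel_measurable S" "v \<in> borel_measurable T"
  shows "indep_var S X T Y"
proof -
  interpret S: sigma_finite_measure S by fact
  interpret T: sigma_finite_measure T by fact
  define c where "c = (\<integral>\<^sup>+x. u x \<partial>S)"
  define d where "d = (\<integral>\<^sup>+y. v y \<partial>T)"
  have X: "distributed M S X (\<lambda>x. u x * d)"
    using distr_marginal1[OF S T XY] by (simp add: d_def nn_integral_cmult)
  have Y: "distributed M T Y (\<lambda>y. c * v y)"
    using distr_marginal2[OF S T XY] by (simp add: c_def nn_integral_multc)
  note X_rv = distributed_measurable[OF X] and Y_rv = distributed_measurable[OF Y]
  \<comment> \<open>The first interpretation provides the total mass behind
    \<open>c * d = 1\<close>, the second the sigma-finiteness required by
    \<open>pair_measure_density\<close>.\<close>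
  interpret X: prob_space "density S (\<lambda>x. u x * d)"
    using prob_space_distr[OF X_rv] by (simp add: distributed_distr_eq_density[OF X])
  interpret Y: prob_space "density T (\<lambda>y. c * v y)"
    using prob_space_distr[OF Y_rv] by (simp add: distributed_distr_eq_density[OF Y])
  have "c * d = 1"
    using X.emeasure_space_1
    by (simp add: c_def emeasure_density nn_integral_multc cong: nn_integral_cong)
  then have "u x * d * (c * v y) = u x * v y" for x y
    by (metis mult.assoc mult.commute mult.left_neutral)
  then have "distr M S X \<Otimes>\<^sub>M distr M T Y = distr M (S \<Otimes>\<^sub>M T) (\<lambda>\<omega>. (X \<omega>, Y \<omega>))"
    unfolding distributed_distr_eq_density[OF X] distributed_distr_eq_density[OF Y]
      distributed_distr_eq_density[OF XY]
    by (subst pair_measure_density)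
      (simp_all add: T.sigma_finite_measure_axioms Y.sigma_finite_measure_axioms)
  then show ?thesis
    using X_rv Y_rv by (simp add: indep_var_distribution_eq)
qed

text \<open>Independence sees the target measures only through their measurable sets. This allows
  passing from \<open>borel\<close> to \<open>lborel\<close>, where densities live.\<close>

lemma (in prob_space) indep_var_cong_sets:
  assumes "sets S = sets S'" "sets T = sets T'"
  shows "indep_var S X T Y \<longleftrightarrow> indep_var S' X T' Y"
  using assms by (simp add: indep_var_eq cong: measurable_cong_sets)

text \<open>Serves to turn almost-everywhere equalities of continuous functions into equalities
  everywhere: the set where they agree is closed.\<close>

lemma mem_closed_if_AE_lborel:
  fixes C :: "'a::euclidean_space set"
  assumes "closed C" "AE x in lborel. x \<in> C"
  shows "x \<in> C"
  using assms by (intro mem_closed_if_AE_lebesgue) (auto intro: AE_completion)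

text \<open>Where all four values factor, both sides equal \<open>u s * u r * v t * v q\<close>, and
  \<open>u\<close> and \<open>v\<close> drop out. The exceptional null set in y depends on x, so the
  points are freed one at a time: t, q, s, r.\<close>

lemma factorization_if_AE_eq_mult:
  fixes f :: "real \<times> real \<Rightarrow> real" and u v :: "real \<Rightarrow> ennreal"
  assumes pos: "\<And>x. f x > 0" and cont: "continuous_on UNIV f"
    and AE: "AE x in lborel. AE y in lborel. ennreal (f (x, y)) = u x * v y"
  shows "f (s, t) * f (r, q) = f (s, q) * f (r, t)"
proof -
  have cont1: "continuous_on UNIV (\<lambda>x. f (x, y))" for y
    by (intro continuous_on_compose2[OF cont] continuous_intros) auto
  have cont2: "continuous_on UNIV (\<lambda>y. f (x, y))" for x
    by (intro continuous_on_compose2[OF cont] continuous_intros) auto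
  define good where "good x \<longleftrightarrow> (AE y in lborel. ennreal (f (x, y)) = u x * v y)" for x
  have cross: "f (s, t) * f (r, q) = f (s, q) * f (r, t)" if "good s" "good r" for s r t q
  proof -
    have *: "f (s, t) * f (r, q) = f (s, q) * f (r, t)"
      if "ennreal (f (s, t)) = u s * v t" "ennreal (f (r, t)) = u r * v t"
        "ennreal (f (s, q)) = u s * v q" "ennreal (f (r, q)) = u r * v q" for t q
    proof -
      have "ennreal (f (s, t) * f (r, q)) = ennreal (f (s, q) * f (r, t))"
        using that pos by (simp add: ennreal_mult less_imp_le mult_ac)
      then show ?thesis
        using pos by (simp add: less_imp_le)
    qed
    \<comment> \<open>Almost every q, and then almost every t, avoids the exceptional null sets of
      both \<open>s\<close> and \<open>r\<close>.\<close>
    have "AE q in lborel. AE t in lborel. f (s, t) * f (r, q) = f (s, q) * f (r, t)"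
      using \<open>good s\<close> \<open>good r\<close> unfolding good_def
    proof eventually_elim
      case q: (elim q)
      show ?case
        using \<open>good s\<close> \<open>good r\<close> unfolding good_def
        by eventually_elim (use q * in blast)
    qed
    then have "AE q in lborel. q \<in> {q. f (s, t) * f (r, q) = f (s, q) * f (r, t)}"
    proof eventually_elim
      case (elim q)
      have "t \<in> {t. f (s, t) * f (r, q) = f (s, q) * f (r, t)}"
        using elim
        by (intro mem_closed_if_AE_lborel closed_Collect_eq continuous_intros cont2) simp_all
      then show ?case by simp
    qed
    then have "q \<in> {q. f (s, t) * f (r, q) = f (s, q) * f (r, t)}"
      by (intro mem_closed_if_AE_lborel closed_Collect_eq continuous_intros cont2)
    then show ?thesis by simp
  qed
  have good: "AE x in lborel. good x"
    using AE by (simp add: good_def)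
  \<comment> \<open>The same closure argument in the first coordinate, where almost every point is
    \<open>good\<close>.\<close>
  have "AE r in lborel. r \<in> {r. f (s, t) * f (r, q) = f (s, q) * f (r, t)}"
    using good
  proof eventually_elim
    case r: (elim r)
    have "AE s in lborel. s \<in> {s. f (s, t) * f (r, q) = f (s, q) * f (r, t)}"
      using good by eventually_elim (use r cross in blast)
    then have "s \<in> {s. f (s, t) * f (r, q) = f (s, q) * f (r, t)}"
      by (intro mem_closed_if_AE_lborel closed_Collect_eq continuous_intros cont1)
    then show ?case by simp
  qed
  then have "r \<in> {r. f (s, t) * f (r, q) = f (s, q) * f (r, t)}"
    by (intro mem_closed_if_AE_lborel closed_Collect_eq continuous_intros cont1)
  then show ?thesis by simp
qed

lemma (in prob_space) indep_var_iff_density_factorizes: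
  fixes f :: "real \<times> real \<Rightarrow> real"
  assumes XY: "distributed M lborel (\<lambda>\<omega>. (X \<omega>, Y \<omega>)) (\<lambda>x. ennreal (f x))"
    and pos: "\<And>x. f x > 0" and cont: "continuous_on UNIV f"
  shows "indep_var borel X borel Y \<longleftrightarrow> (\<forall>s t. f (s, t) * f (0, 0) = f (s, 0) * f (0, t))"
proof -
  have lborel: "sigma_finite_measure (lborel :: real measure)"
    by (rule lborel.sigma_finite_measure_axioms)
  have XY': "distributed M (lborel \<Otimes>\<^sub>M lborel) (\<lambda>\<omega>. (X \<omega>, Y \<omega>)) (\<lambda>x. ennreal (f x))"
    using XY by (simp add: lborel_prod)
  have indep: "indep_var borel X borel Y \<longleftrightarrow> indep_var lborel X lborel Y"
    by (rule indep_var_cong_sets) simp_all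
  show ?thesis
    unfolding indep
  proof
    assume "indep_var lborel X lborel Y"
    define u where "u x = (\<integral>\<^sup>+y. ennreal (f (x, y)) \<partial>lborel)" for x
    define v where "v y = (\<integral>\<^sup>+x. ennreal (f (x, y)) \<partial>lborel)" for y
    have "distributed M lborel X u" "distributed M lborel Y v"
      unfolding u_def v_def
      by (rule distr_marginal1[OF lborel lborel XY'], rule distr_marginal2[OF lborel lborel XY'])
    then have "distributed M (lborel \<Otimes>\<^sub>M lborel) (\<lambda>\<omega>. (X \<omega>, Y \<omega>)) (\<lambda>(x, y). u x * v y)"
      using lborel \<open>indep_var lborel X lborel Y\<close> by (intro distributed_joint_indep)
    \<comment> \<open>Densities are unique only almost everywhere on the product space;
      \<open>AE_pair\<close> gives the iterated form.\<close>
    from distributed_unique[OF XY' this]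
    have "AE x in lborel. AE y in lborel. ennreal (f (x, y)) = u x * v y"
      by (auto dest: lborel_pair.AE_pair)
    from factorization_if_AE_eq_mult[OF pos cont this]
    show "\<forall>s t. f (s, t) * f (0, 0) = f (s, 0) * f (0, t)"
      by blast
  next
    assume E: "\<forall>s t. f (s, t) * f (0, 0) = f (s, 0) * f (0, t)"
    \<comment> \<open>The constant \<open>f (0, 0)\<close> is absorbed into the second factor;
      neither factor has to integrate to one.\<close>
    have "f (s, t) = f (s, 0) * (f (0, t) / f (0, 0))" for s t
      using E[rule_format, of s t] pos[of "(0, 0)"] by (simp add: field_simps)
    then have "ennreal (f (s, t)) = ennreal (f (s, 0)) * ennreal (f (0, t) / f (0, 0))" for s t
      using pos by (metis ennreal_mult' less_imp_le)
    then have "(\<lambda>x. ennreal (f x)) =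
        (\<lambda>(s, t). ennreal (f (s, 0)) * ennreal (f (0, t) / f (0, 0)))"
      unfolding fun_eq_iff split_paired_All case_prod_conv by blast
    from subst[OF this, of "distributed M (lborel \<Otimes>\<^sub>M lborel) (\<lambda>\<omega>. (X \<omega>, Y \<omega>))", OF XY']
    show "indep_var lborel X lborel Y"
    proof (rule indep_var_if_distributed_mult[OF lborel lborel])
      have "continuous_on UNIV (\<lambda>s. f (s, 0))" "continuous_on UNIV (\<lambda>t. f (0, t))"
        by (auto intro!: continuous_on_compose2[OF cont] continuous_intros)
      then have [measurable]: "(\<lambda>s. f (s, 0)) \<in> borel_measurable borel"
        "(\<lambda>t. f (0, t)) \<in> borel_measurable borel"
        by (simp_all add: borel_measurable_continuous_onI)
      show "(\<lambda>s. ennreal (f (s, 0))) \<in> borel_measurable lborel"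
        by measurable
      show "(\<lambda>t. ennreal (f (0, t) / f (0, 0))) \<in> borel_measurable lborel"
        by measurable
    qed
  qed
qed

theorem proposition1:
  fixes M :: "'a measure"
    and X1 X2 :: "'a \<Rightarrow> real"
    and f :: "real \<times> real \<Rightarrow> real"
  assumes "prob_space M"
    and "distributed M lborel (\<lambda>\<omega>. (X1 \<omega>, X2 \<omega>)) (\<lambda>x. ennreal (f x))"
    and "\<And>x. f x > 0"
    and "times_continuously_differentiable 3 f"
  shows "prob_space.indep_var M borel X1 borel X2 \<longleftrightarrow> (\<forall>x. kappa11 f x = 0)"
proof -
  \<comment> \<open>Writing 3 with leading \<open>Suc\<close> matches the cumulant criterion at k =
    1 and lets the recursion equation expose continuity of \<open>f\<close>.\<close>
  have C: "times_continuously_differentiable (Suc (Suc 1)) f"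
    using assms(4) by (simp only: numeral_3_eq_3 One_nat_def)
  then have "continuous_on UNIV f"
    by simp
  with assms C show ?thesis
    by (simp only: prob_space.indep_var_iff_density_factorizes kappa11_eq_0_iff)
qed

end
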